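(* Let $t,s$ be positive integers, $\alpha$ a primitive element of $\mathbb{F}_{q^t}$ with minimal polynomial $m_\alpha$ over $\mathbb{F}_q$, and $C$ a nonempty subset of $[0,q^t-2]$. Then the following statements are equivalent. 1. The $q^t\times|C|$ array $\mathcal{A}_{\mathbf 0}(\alpha,C)$ is a linear $\mathrm{OA}_{q^{t-s}}(s,|C|,q)$. 2. The set $\{\alpha^c\mid c\in C\}$ is a $(|C|,s)$-set over $\mathbb{F}_q$. 3. The set $\{L^{c}_{q^t-1}(\mathrm{Seq}(\alpha))\mid c\in C\}$ is a $(|C|,s)$-set over $\mathbb{F}_q$. 4. For every (distinct) $c_0,\dots,c_{s-1}\in C$ and $d_0,\dots,d_{s-1}\in\mathbb{F}_q$ not all zero, $m_\alpha(x)$ does not divide $\sum_{j=0}^{s-1}d_jx^{c_j}$. 5. For every $s$ points in $\{[\alpha^c]\mid c\in C\}$, there is no $(s-2)$-flat in $PG(t-1,q)$ that contains them.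
   Context: $q$ is a prime power. For integers $a\le b$, $[a,b]=\{a,\dots,b\}$. A primitive element of a finite field is a generator of its multiplicative group. $\mathrm{Tr}(x)=x+x^q+\dots+x^{q^{t-1}}$ is the trace from $\mathbb{F}_{q^t}$ to $\mathbb{F}_q$. For an ordered set $C=\{c_0,\dots,c_{k-1}\}\subseteq[0,q^t-2]$, $\mathcal{A}_{\mathbf 0}(\alpha,C)$ is the $q^t\times k$ array over $\mathbb{F}_q$ whose row $i$, for $i\in[0,q^t-2]$, is $(\mathrm{Tr}(\alpha^{i+c_0}),\dots,\mathrm{Tr}(\alpha^{i+c_{k-1}}))$ and whose last row is all zeros. $\mathrm{Seq}(\alpha)=(\mathrm{Tr}(\alpha^i))_{i\ge0}$ and $L^c_n(\mathrm{Seq}(\alpha))=(\mathrm{Tr}(\alpha^{i+c}))_{i=0}^{n-1}\in\mathbb{F}_q^n$. An orthogonal array $\mathrm{OA}_\lambda(s,k,v)$ ($s\le k$) is a $\lambda v^s\times k$ array over an alphabet $V$ of size $v$ such that for every $s$ columns, each element of $V^s$ occurs exactly $\lambda$ times as a row of the subarray formed by these columns. An $\mathrm{OA}_\lambda(s,k,q)$ with entries in $\mathbb{F}_q$ is called linear if its row vectors are distinct and form a subspace of $\mathbb{F}_q^k$. A $(k,s)$-set over a field $F$ ($s\le k$) is a set of $k$ elements of an $F$-vector space every subset of size $s$ of which is linearly independent over $F$. $PG(t-1,q)$ is the projective space whose points are the one-dimensional $\mathbb{F}_q$-subspaces of $\mathbb{F}_{q^t}$; $[x]$ is the point represented by $x\neq0$.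 A $k$-flat is the set of points $\{[x]\mid x\in S\setminus\{0\}\}$ for an $\mathbb{F}_q$-subspace $S$ of dimension $k+1$.
   Formalization: Item 1 with distinct rows is shown equivalent only when the α^c span F_{q^t}; without distinctness it is for all C. Item 5 is included only for s ≤ t+1, its s points being those of s distinct c in C. Also s ≤ |C|. Literal claim fails: q=t=2, s=1, C={0}; q=4, t=1, s=3, C={0,1,2}. *)

theory Defs
  imports
    "HOL-Computational_Algebra.Polynomial"
    "HOL-Library.Cardinality"
    "HOL-Library.FuncSet"
    "HOL-Library.Function_Algebras"
begin

section \<open>The extension of finite fields\<close>

text \<open>
  The field with \<open>q\<close> elements is a type \<open>'f :: {field, finite}\<close>, with \<open>q = CARD('f)\<close>
  (necessarily a prime power); the field with \<open>q^t\<close> elements is a type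
  \<open>'e :: {field, finite}\<close> with \<open>CARD('e) = q^t\<close>, regarded as an extension of \<open>'f\<close> along an
  arbitrary field homomorphism \<open>emb\<close>.
\<close>

definition field_embedding :: "('f::field \<Rightarrow> 'e::field) \<Rightarrow> bool" where
  "field_embedding emb \<longleftrightarrow>
     emb 1 = 1 \<and>
     (\<forall>x y. emb (x + y) = emb x + emb y) \<and>
     (\<forall>x y. emb (x * y) = emb x * emb y)"

definition ext_scale :: "('f::field \<Rightarrow> 'e::field) \<Rightarrow> 'f \<Rightarrow> 'e \<Rightarrow> 'e" where
  "ext_scale emb d x = emb d * x"

lemma vector_space_ext_scale: "field_embedding emb \<Longrightarrow> vector_space (ext_scale emb)"
  by unfold_locales (simp_all add: field_embedding_def ext_scale_def algebra_simps)

definition primitive_element :: "'e::field \<Rightarrow> bool" where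
  "primitive_element \<alpha> \<longleftrightarrow> range (\<lambda>i::int. \<alpha> powi i) = - {0}"

text \<open>The sum lies in the image of \<open>emb\<close>; it is pulled back to an element of \<open>'f\<close>.\<close>

definition field_trace :: "('f::{field,finite} \<Rightarrow> 'e::{field,finite}) \<Rightarrow> nat \<Rightarrow> 'e \<Rightarrow> 'f" where
  "field_trace emb t x = inv emb (\<Sum>i<t. x ^ (CARD('f) ^ i))"

definition is_minimal_polynomial :: "('f::field \<Rightarrow> 'e::field) \<Rightarrow> 'e \<Rightarrow> 'f poly \<Rightarrow> bool" where
  "is_minimal_polynomial emb \<alpha> m \<longleftrightarrow>
     lead_coeff m = 1 \<and> poly (map_poly emb m) \<alpha> = 0 \<and>
     (\<forall>p. p \<noteq> 0 \<and> poly (map_poly emb p) \<alpha> = 0 \<longrightarrow> degree m \<le> degree p)"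

section \<open>Tuples\<close>

text \<open>
  The space of \<open>n\<close>-tuples over \<open>'f\<close> is the space of those functions \<open>nat \<Rightarrow> 'f\<close> that vanish
  outside \<open>{..<n}\<close>, with the pointwise operations.
\<close>

definition tuple :: "nat \<Rightarrow> (nat \<Rightarrow> 'f::zero) \<Rightarrow> nat \<Rightarrow> 'f" where
  "tuple n f = (\<lambda>i. if i < n then f i else 0)"

definition tuple_scale :: "'f::field \<Rightarrow> (nat \<Rightarrow> 'f) \<Rightarrow> nat \<Rightarrow> 'f" where
  "tuple_scale d f = (\<lambda>i. d * f i)"

lemma vector_space_tuple_scale: "vector_space tuple_scale"
  by unfold_locales (auto simp: tuple_scale_def plus_fun_def algebra_simps)

section \<open>Orthogonal arrays\<close>

text \<open>
  An \<open>N \<times> k\<close> array is a function \<open>A\<close> with entry \<open>A i j\<close> in row \<open>i < N\<close> and column \<open>j < k\<close>.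
  The condition \<open>N = lam * card V ^ s\<close> is not redundant: with \<open>N = q^t\<close> and the truncated
  exponent in \<open>lam = q^(t - s)\<close> it is what makes the property false for \<open>s > t\<close>.
\<close>

definition orthogonal_array ::
  "nat \<Rightarrow> nat \<Rightarrow> nat \<Rightarrow> 'v set \<Rightarrow> nat \<Rightarrow> (nat \<Rightarrow> nat \<Rightarrow> 'v) \<Rightarrow> bool" where
  "orthogonal_array lam s k V N A \<longleftrightarrow>
     s \<le> k \<and> N = lam * card V ^ s \<and>
     (\<forall>i<N. \<forall>j<k. A i j \<in> V) \<and>
     (\<forall>J\<subseteq>{..<k}. card J = s \<longrightarrow>
        (\<forall>w\<in>J \<rightarrow> V. card {i. i < N \<and> (\<forall>j\<in>J. A i j = w j)} = lam))"

definition row_set :: "nat \<Rightarrow> nat \<Rightarrow> (nat \<Rightarrow> nat \<Rightarrow> 'f::zero) \<Rightarrow> (nat \<Rightarrow> 'f) set" where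
  "row_set k N A = (\<lambda>i. tuple k (A i)) ` {..<N}"

definition distinct_rows :: "nat \<Rightarrow> nat \<Rightarrow> (nat \<Rightarrow> nat \<Rightarrow> 'f::zero) \<Rightarrow> bool" where
  "distinct_rows k N A \<longleftrightarrow> inj_on (\<lambda>i. tuple k (A i)) {..<N}"

definition linear_orthogonal_array ::
  "nat \<Rightarrow> nat \<Rightarrow> nat \<Rightarrow> nat \<Rightarrow> (nat \<Rightarrow> nat \<Rightarrow> 'f::{field,finite}) \<Rightarrow> bool" where
  "linear_orthogonal_array lam s k N A \<longleftrightarrow>
     orthogonal_array lam s k UNIV N A \<and> distinct_rows k N A \<and>
     module.subspace tuple_scale (row_set k N A)"

text \<open>
  The same without distinctness of the rows. An array whose columns come from powers of
  \<open>\<alpha>\<close> that do not span the big field has repeated rows, so it can be linear only in this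
  sense, even when it is an orthogonal array (e.g. \<open>q = t = 2\<close>, \<open>s = 1\<close>, the single column
  \<open>(Tr 1, Tr \<alpha>, Tr (\<alpha>^2), 0) = (0, 1, 1, 0)\<close>).
\<close>

definition linear_orthogonal_array_rep ::
  "nat \<Rightarrow> nat \<Rightarrow> nat \<Rightarrow> nat \<Rightarrow> (nat \<Rightarrow> nat \<Rightarrow> 'f::{field,finite}) \<Rightarrow> bool" where
  "linear_orthogonal_array_rep lam s k N A \<longleftrightarrow>
     orthogonal_array lam s k UNIV N A \<and>
     module.subspace tuple_scale (row_set k N A)"

text \<open>The ordered set of exponents is a list without repetitions.\<close>

definition trace_array ::
  "('f::{field,finite} \<Rightarrow> 'e::{field,finite}) \<Rightarrow> nat \<Rightarrow> 'e \<Rightarrow> nat list \<Rightarrow> nat \<Rightarrow> nat \<Rightarrow> 'f" where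
  "trace_array emb t \<alpha> cs i j =
     (if i < CARD('e) - 1 then field_trace emb t (\<alpha> ^ (i + cs ! j)) else 0)"

definition trace_seq ::
  "('f::{field,finite} \<Rightarrow> 'e::{field,finite}) \<Rightarrow> nat \<Rightarrow> 'e \<Rightarrow> nat \<Rightarrow> 'f" where
  "trace_seq emb t \<alpha> i = field_trace emb t (\<alpha> ^ i)"

definition shift_window :: "nat \<Rightarrow> nat \<Rightarrow> (nat \<Rightarrow> 'f::zero) \<Rightarrow> nat \<Rightarrow> 'f" where
  "shift_window n c a = tuple n (\<lambda>i. a (i + c))"

section \<open>Sets with independent subsets, and flats\<close>

definition ks_set :: "('f::field \<Rightarrow> 'v::ab_group_add \<Rightarrow> 'v) \<Rightarrow> nat \<Rightarrow> nat \<Rightarrow> 'v set \<Rightarrow> bool" where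
  "ks_set scale k s S \<longleftrightarrow>
     s \<le> k \<and> finite S \<and> card S = k \<and>
     (\<forall>T\<subseteq>S. card T = s \<longrightarrow> \<not> module.dependent scale T)"

definition proj_point :: "('f::field \<Rightarrow> 'e::field) \<Rightarrow> 'e \<Rightarrow> 'e set" where
  "proj_point emb x = module.span (ext_scale emb) {x}"

text \<open>The dimension is an integer because the \<open>(-1)\<close>-flat (the empty set) occurs.\<close>

definition is_flat :: "('f::field \<Rightarrow> 'e::field) \<Rightarrow> int \<Rightarrow> 'e set set \<Rightarrow> bool" where
  "is_flat emb k F \<longleftrightarrow>
     (\<exists>S. module.subspace (ext_scale emb) S \<and>
          int (vector_space.dim (ext_scale emb) S) = k + 1 \<and>
          F = proj_point emb ` (S - {0}))"

end

theory Submission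
  imports Defs
begin

text \<open>
  The form \<open>(x, y) \<mapsto> Tr (x * y)\<close> is nondegenerate. Hence for a basis \<open>B\<close> of the big field
  the map sending \<open>x\<close> to \<open>(Tr (x * b))\<^sub>b\<close> is a bijection onto the functions from \<open>B\<close> to the
  small field, and prescribing the values at an independent subset \<open>A\<close> of \<open>B\<close> leaves
  \<open>q ^ (t - card A)\<close> choices of \<open>x\<close>. The rows of the array are indexed by these \<open>x\<close>, so
  independence gives the orthogonal array property; conversely a linear relation between columns
  prevents some rows from occurring. Nondegeneracy also makes the passage from \<open>x\<close> to its trace
  sequence an injective linear map, and divisibility by the minimal polynomial says that a linear
  combination of powers of \<open>\<alpha>\<close> vanishes.
\<close>

section \<open>Finite fields\<close>

text \<open>Multiplication by a nonzero \<open>x\<close> permutes the nonzero elements; comparing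
  their products gives \<open>x ^ card ?U = 1\<close>.\<close>

lemma power_card_field:
  fixes x :: "'a::{field,finite}"
  shows "x ^ CARD('a) = x"
proof (cases "x = 0")
  case False
  let ?U = "- {0::'a}"
  have bij: "bij_betw ((*) x) ?U ?U"
    by (rule bij_betw_byWitness[where f' = "\<lambda>y. y / x"]) (use False in auto)
  have card: "CARD('a) = Suc (card ?U)"
    by (subst card_Suc_Diff1[of UNIV 0, symmetric]) (auto simp: Compl_eq_Diff_UNIV)
  have "\<Prod>?U = (\<Prod>y\<in>?U. x * y)"
    using prod.reindex_bij_betw[OF bij, of "\<lambda>y. y"] by simp
  also have "\<dots> = x ^ card ?U * \<Prod>?U"
    by (simp add: prod.distrib)
  finally have "x ^ card ?U = 1"
    by simp
  then show ?thesis
    by (simp add: card)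
qed (simp add: power_0_left)

lemma card_field_ge_2: "CARD('a::{field,finite}) \<ge> 2"
  using card_mono[of UNIV "{0, 1::'a}"] by simp

lemma poly_eq_0_of_roots:
  fixes p :: "'a::idom poly"
  assumes "\<And>x. x \<in> S \<Longrightarrow> poly p x = 0" "finite S" "degree p < card S"
  shows "p = 0"
proof (rule ccontr)
  assume p: "p \<noteq> 0"
  then have "card S \<le> card {x. poly p x = 0}"
    using assms(1) by (intro card_mono poly_roots_finite) auto
  with card_poly_roots_bound[OF p] assms(3) show False
    by linarith
qed

text \<open>The polynomial \<open>(X + 1)^q - X^q - 1\<close> has degree below \<open>q\<close> and
  vanishes at all \<open>q\<close> elements, since \<open>x^q = x\<close>; so its coefficients are
  zero.\<close>

lemma binomial_card_field_eq_0:
  assumes "0 < i" "i < CARD('f::{field,finite})"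
  shows "of_nat (CARD('f) choose i) = (0 :: 'f)"
proof -
  let ?q = "CARD('f)"
  define p :: "'f poly" where "p = (\<Sum>i\<in>{1..<?q}. monom (of_nat (?q choose i)) i)"
  have "poly p x = 0" for x
  proof -
    have "{..?q} = insert 0 (insert ?q {1..<?q})"
      by auto
    then have "(x + 1) ^ ?q = 1 + (x ^ ?q + poly p x)"
      using card_field_ge_2[where 'a = 'f]
      by (simp add: binomial_ring p_def poly_sum poly_monom)
    then show ?thesis
      by (simp only: power_card_field) simp
  qed
  moreover have "degree p \<le> ?q - 1"
    unfolding p_def by (intro degree_sum_le) (auto intro: order.trans[OF degree_monom_le])
  ultimately have "p = 0"
    using card_field_ge_2[where 'a = 'f] by (intro poly_eq_0_of_roots[of UNIV]) auto
  then have "coeff p i = 0"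
    by simp
  then show ?thesis
    using assms by (simp add: p_def coeff_sum sum.delta)
qed

text \<open>Integer exponents can be reduced modulo \<open>CARD('e) - 1\<close>. The residues then
  cover as many elements as there are residues, so no power repeats.\<close>

lemma primitive_element_bij_betw:
  fixes \<alpha> :: "'e::{field,finite}"
  assumes "primitive_element \<alpha>"
  shows "bij_betw (\<lambda>i. \<alpha> ^ i) {..<CARD('e) - 1} (- {0})"
proof -
  let ?n = "CARD('e) - 1"
  have n: "?n > 0"
    using card_field_ge_2[where 'a = 'e] by simp
  have ran: "range (\<lambda>i::int. \<alpha> powi i) = - {0}"
    using assms by (simp add: primitive_element_def)
  have "\<alpha> powi 1 \<in> - {0}"
    unfolding ran[symmetric] by blast
  then have nz: "\<alpha> \<noteq> 0"
    by simp
  have "\<alpha> * \<alpha> ^ ?n = \<alpha> * 1"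
    using power_card_field[of \<alpha>] by (simp flip: power_Suc)
  then have one: "\<alpha> ^ ?n = 1"
    using nz by simp
  have "x \<in> (\<lambda>i. \<alpha> ^ i) ` {..<?n}" if "x \<noteq> 0" for x
  proof -
    from that ran obtain i where i: "x = \<alpha> powi i"
      by blast
    have "\<alpha> powi i = \<alpha> powi (int ?n * (i div int ?n) + i mod int ?n)"
      by simp
    also have "\<dots> = (\<alpha> powi int ?n) powi (i div int ?n) * \<alpha> powi (i mod int ?n)"
      using nz by (simp only: power_int_add power_int_mult simp_thms)
    also have "\<dots> = \<alpha> powi (i mod int ?n)"
      by (simp only: one power_int_of_nat power_int_1_left mult_1_left)
    also have "\<dots> = \<alpha> ^ nat (i mod int ?n)"
      using n by (simp add: power_int_def)
    finally show ?thesis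
      using i n by (auto simp: nat_less_iff)
  qed
  then have img: "(\<lambda>i. \<alpha> ^ i) ` {..<?n} = - {0}"
    using nz by auto
  moreover have "card (- {0::'e}) = ?n"
    by (simp add: Compl_eq_Diff_UNIV card_Diff_singleton)
  ultimately show ?thesis
    by (auto simp: bij_betw_def intro: eq_card_imp_inj_on)
qed

text \<open>Brings \<open>P2\<close> and \<open>P3\<close> to a common form that speaks of sets of
  exponents; injectivity preserves the sizes.\<close>

lemma ks_set_image_iff:
  assumes "inj_on f C" "finite C"
  shows "ks_set scale (card C) s (f ` C) \<longleftrightarrow>
    s \<le> card C \<and> (\<forall>D\<subseteq>C. card D = s \<longrightarrow> \<not> module.dependent scale (f ` D))"
proof -
  have card: "card (f ` D) = card D" if "D \<subseteq> C" for D
    using inj_on_subset[OF assms(1) that] by (rule card_image)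
  show ?thesis
    unfolding ks_set_def all_subset_image using assms(2) card by auto
qed

section \<open>The trace form\<close>

locale finite_extension =
  fixes emb :: "'f::{field,finite} \<Rightarrow> 'e::{field,finite}" and t :: nat
  assumes embedding: "field_embedding emb"
    and card_ext: "CARD('e) = CARD('f) ^ t"
begin

abbreviation Tr :: "'e \<Rightarrow> 'f" where "Tr \<equiv> field_trace emb t"

sublocale vector_space "ext_scale emb"
  by (rule vector_space_ext_scale[OF embedding])

section \<open>The embedding and the Frobenius map\<close>

lemma emb_1 [simp]: "emb 1 = 1"
  and emb_add [simp]: "emb (x + y) = emb x + emb y"
  and emb_mult [simp]: "emb (x * y) = emb x * emb y"
  using embedding by (simp_all add: field_embedding_def)

lemma emb_0 [simp]: "emb 0 = 0"
  by (metis emb_add add_0 add_cancel_right_right)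

lemma emb_power [simp]: "emb (x ^ n) = emb x ^ n"
  by (induction n) auto

lemma emb_of_nat [simp]: "emb (of_nat n) = of_nat n"
  by (induction n) auto

lemma inj_emb: "inj emb"
proof (rule injI)
  fix x y assume eq: "emb x = emb y"
  have "emb (x - y) + emb y = emb x"
    by (simp flip: emb_add)
  with eq have "emb (x - y) = 0"
    by simp
  then have "emb ((x - y) * inverse (x - y)) = 0"
    by (simp only: emb_mult) simp
  moreover have "(x - y) * inverse (x - y) = 1" if "x \<noteq> y"
    using that by simp
  ultimately show "x = y"
    by (metis emb_1 zero_neq_one)
qed

text \<open>The inner binomial coefficients vanish in the small field, hence also in the large one
  through \<open>emb\<close>.\<close>

lemma frobenius_add: "(x + y :: 'e) ^ CARD('f) = x ^ CARD('f) + y ^ CARD('f)"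
proof -
  let ?q = "CARD('f)"
  have "of_nat (?q choose i) = (0 :: 'e)" if "i \<in> {1..<?q}" for i
    using that binomial_card_field_eq_0[where 'f = 'f, of i] emb_of_nat[of "?q choose i"] by simp
  moreover have "{..?q} = insert 0 (insert ?q {1..<?q})"
    by auto
  ultimately show ?thesis
    using card_field_ge_2[where 'a = 'f] by (simp add: binomial_ring)
qed

lemma frobenius_sum:
  "(\<Sum>i\<in>A. g i :: 'e) ^ CARD('f) = (\<Sum>i\<in>A. g i ^ CARD('f))"
  by (induction A rule: infinite_finite_induct) (auto simp: frobenius_add power_0_left)

lemma frobenius_power_add:
  "(x + y :: 'e) ^ (CARD('f) ^ i) = x ^ (CARD('f) ^ i) + y ^ (CARD('f) ^ i)"
proof (induction i)
  case (Suc i)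
  have "z ^ (CARD('f) ^ Suc i) = (z ^ (CARD('f) ^ i)) ^ CARD('f)" for z :: 'e
    by (simp only: power_Suc2 power_mult)
  then show ?case
    by (simp only: Suc.IH frobenius_add)
qed simp

lemma power_card_power: "(d :: 'f) ^ (CARD('f) ^ i) = d"
  by (induction i) (auto simp: power_mult power_card_field)

text \<open>The image consists of \<open>q\<close> roots of \<open>X^q - X\<close>, which has no
  more than \<open>q\<close>; so it is the whole fixed field of the Frobenius map.\<close>

lemma range_emb: "range emb = {x. x ^ CARD('f) = x}"
proof (rule card_seteq)
  let ?q = "CARD('f)"
  show "range emb \<subseteq> {x. x ^ ?q = x}"
    by (auto simp: power_card_field simp flip: emb_power)
  define p :: "'e poly" where "p = monom 1 ?q - monom 1 1"
  have "coeff p ?q = 1"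
    using card_field_ge_2[where 'a = 'f] by (simp add: p_def)
  then have "p \<noteq> 0"
    by auto
  moreover have "degree p \<le> ?q"
    using card_field_ge_2[where 'a = 'f] unfolding p_def
    by (intro degree_diff_le) (auto intro: order.trans[OF degree_monom_le])
  moreover have "{x. x ^ ?q = x} = {x. poly p x = 0}"
    by (simp add: p_def poly_monom)
  ultimately show "card {x :: 'e. x ^ ?q = x} \<le> card (range emb)"
    using card_poly_roots_bound[of p] by (simp add: card_image[OF inj_emb])
qed simp

section \<open>The trace and its nondegeneracy\<close>

lemma emb_trace: "emb (Tr x) = (\<Sum>i<t. x ^ (CARD('f) ^ i))"
proof -
  let ?q = "CARD('f)"
  \<comment> \<open>The Frobenius map moves each term to the next, and the last one returns to
    \<open>x\<close> because \<open>x ^ (q^t) = x\<close>. The sum is thus fixed, so the trace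
    applies \<open>inv emb\<close> only to values in the range of \<open>emb\<close>.\<close>
  have "(\<Sum>i<t. x ^ (?q ^ i)) ^ ?q = (\<Sum>i<t. x ^ (?q ^ Suc i))"
    by (simp add: frobenius_sum mult.commute[of ?q] flip: power_mult)
  moreover have "x + (\<Sum>i<t. x ^ (?q ^ Suc i)) = (\<Sum>i<t. x ^ (?q ^ i)) + x ^ (?q ^ t)"
    using sum.lessThan_Suc_shift[of "\<lambda>i. x ^ (?q ^ i)" t] by simp
  moreover have "x ^ (?q ^ t) = x"
    using power_card_field[of x] by (simp add: card_ext)
  ultimately have "(\<Sum>i<t. x ^ (?q ^ i)) \<in> range emb"
    by (simp add: range_emb)
  then show ?thesis
    unfolding field_trace_def by (rule f_inv_into_f)
qed

lemma trace_add: "Tr (x + y) = Tr x + Tr y"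
  using inj_emb by (rule injD) (simp add: emb_trace frobenius_power_add sum.distrib)

lemma trace_scale: "Tr (ext_scale emb d x) = d * Tr x"
proof (rule injD[OF inj_emb])
  show "emb (Tr (ext_scale emb d x)) = emb (d * Tr x)"
    by (simp add: emb_trace ext_scale_def power_mult_distrib sum_distrib_left power_card_power
        flip: emb_power)
qed

lemma trace_0 [simp]: "Tr 0 = 0"
  by (metis trace_add add_0 add_cancel_right_right)

lemma trace_sum: "Tr (sum g A) = (\<Sum>i\<in>A. Tr (g i))"
  by (induction A rule: infinite_finite_induct) (auto simp: trace_add)

lemma trace_mult_scale: "Tr (x * ext_scale emb d y) = d * Tr (x * y)"
proof -
  have "x * ext_scale emb d y = ext_scale emb d (x * y)"
    by (simp add: ext_scale_def)
  then show ?thesis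
    by (simp only: trace_scale)
qed

text \<open>The trace is given by a polynomial of degree below \<open>q^t\<close> whose coefficient
  at \<open>X\<close> is 1, so it cannot vanish at all \<open>q^t\<close> elements.\<close>

lemma ex_trace_nonzero: "\<exists>x. Tr x \<noteq> 0"
proof (rule ccontr)
  let ?q = "CARD('f)"
  assume "\<nexists>x. Tr x \<noteq> 0"
  then have zero: "emb (Tr x) = 0" for x
    by simp
  have q: "?q > 1"
    using card_field_ge_2[where 'a = 'f] by simp
  have t: "t > 0"
    using card_field_ge_2[where 'a = 'e] card_ext by (cases t) auto
  define p :: "'e poly" where "p = (\<Sum>i<t. monom 1 (?q ^ i))"
  have "degree p \<le> ?q ^ (t - 1)"
    unfolding p_def using q t
    by (intro degree_sum_le) (auto simp: degree_monom_eq intro!: power_increasing)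
  moreover have "?q ^ (t - 1) < CARD('e)"
    unfolding card_ext using q t by (intro power_strict_increasing) auto
  ultimately have "p = 0"
    using zero by (intro poly_eq_0_of_roots[of UNIV]) (auto simp: p_def poly_sum poly_monom emb_trace)
  \<comment> \<open>Only \<open>i = 0\<close> gives the exponent 1, as \<open>q > 1\<close>.\<close>
  moreover have "coeff p 1 = (\<Sum>i<t. if i = 0 then 1 else 0)"
    unfolding p_def coeff_sum using q by (intro sum.cong) auto
  ultimately show False
    using t by simp
qed

text \<open>For \<open>x \<noteq> 0\<close> the products \<open>x * y\<close> run through the whole
  field, so the trace itself would be zero.\<close>

lemma trace_form_nondegenerate:
  assumes "\<And>y. Tr (x * y) = 0"
  shows "x = 0"
proof (rule ccontr)
  assume "x \<noteq> 0"
  then have "Tr y = 0" for y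
    using assms[of "y / x"] by simp
  then show False
    using ex_trace_nonzero by simp
qed

text \<open>The elements at which the two functionals agree form a subspace; when it is everything,
  \<open>x - y\<close> lies in the radical of the form.\<close>

lemma trace_form_eq_on_span:
  assumes "\<And>a. a \<in> A \<Longrightarrow> Tr (x * a) = Tr (y * a)" "span A = UNIV"
  shows "x = y"
proof -
  let ?S = "{z. Tr (x * z) = Tr (y * z)}"
  have "subspace ?S"
    by (auto intro!: subspaceI simp: trace_add trace_mult_scale distrib_left)
  then have "span A \<subseteq> ?S"
    using assms(1) by (intro span_minimal) auto
  then have "Tr ((x - y) * z) + Tr (y * z) = Tr (y * z)" for z
    using assms(2) unfolding trace_add[symmetric] by (auto simp: algebra_simps)
  then show "x = y"
    using trace_form_nondegenerate[of "x - y"] by simp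
qed

section \<open>Bases and fibres of the trace form\<close>

lemma card_basis:
  assumes "independent B" "span B = UNIV"
  shows "card B = t"
proof -
  \<comment> \<open>The map from coordinates to elements: its bijectivity forces
    \<open>q^t = q^(card B)\<close>.\<close>
  let ?F = "\<lambda>u. \<Sum>b\<in>B. ext_scale emb (u b) b"
  have fin: "finite B"
    by simp
  have "inj_on ?F (B \<rightarrow>\<^sub>E UNIV)"
  proof (rule inj_onI)
    fix u v assume uv: "u \<in> B \<rightarrow>\<^sub>E UNIV" "v \<in> B \<rightarrow>\<^sub>E UNIV" "?F u = ?F v"
    then have "(\<Sum>b\<in>B. ext_scale emb (u b - v b) b) = 0"
      by (simp add: scale_left_diff_distrib sum_subtractf)
    then have "u b - v b = 0" if "b \<in> B" for b
      by (rule independentD[OF assms(1) fin order_refl _ that])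
    with uv(1,2) show "u = v"
      by (intro PiE_ext) auto
  qed
  then have "card (?F ` (B \<rightarrow>\<^sub>E UNIV)) = card (B \<rightarrow>\<^sub>E (UNIV :: 'f set))"
    by (rule card_image)
  moreover have "?F ` (B \<rightarrow>\<^sub>E UNIV) = UNIV"
  proof -
    have "?F u = ?F (restrict u B)" for u
      by (intro sum.cong) auto
    then have "range ?F \<subseteq> ?F ` (B \<rightarrow>\<^sub>E UNIV)"
      by (auto simp: image_iff intro!: bexI[of _ "restrict _ B"])
    then show ?thesis
      using assms(2) span_finite[OF fin] by auto
  qed
  ultimately have "CARD('f) ^ t = CARD('f) ^ card B"
    by (simp add: card_ext card_PiE)
  then show ?thesis
    using card_field_ge_2[where 'a = 'f] by (simp add: power_inject_exp)
qed

lemma extend_to_basis: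
  assumes "independent A"
  obtains B where "A \<subseteq> B" "independent B" "span B = UNIV" "card B = t"
proof -
  obtain B where B: "A \<subseteq> B" "independent B" "UNIV \<subseteq> span B"
    by (rule maximal_independent_subset_extend[OF subset_UNIV assms])
  then have "span B = UNIV"
    by auto
  with B show thesis
    using card_basis that by blast
qed

lemma independent_card_le:
  assumes "independent A"
  shows "card A \<le> t"
proof -
  obtain B where "A \<subseteq> B" "card B = t"
    using extend_to_basis[OF assms] by blast
  then show ?thesis
    using card_mono[of B A] by simp
qed

lemma card_trace_fiber:
  assumes "independent A"
  shows "card {x. \<forall>a\<in>A. Tr (x * a) = w a} = CARD('f) ^ (t - card A)"
proof -
  obtain B where B: "A \<subseteq> B" "independent B" "span B = UNIV" "card B = t"
    using extend_to_basis[OF assms] .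
  let ?\<Phi> = "\<lambda>x. restrict (\<lambda>b. Tr (x * b)) B"
  have inj: "inj ?\<Phi>"
  proof (rule injI)
    fix x y assume "?\<Phi> x = ?\<Phi> y"
    then show "x = y"
      using B(3) by (intro trace_form_eq_on_span[of B]) (metis restrict_apply')
  qed
  \<comment> \<open>Both sides have \<open>q^t\<close> elements, so the inclusion is an
    equality.\<close>
  have surj: "range ?\<Phi> = B \<rightarrow>\<^sub>E UNIV"
    using B(4) by (intro card_subset_eq) (auto simp: card_image[OF inj] card_ext card_PiE finite_PiE)
  \<comment> \<open>The value vectors with the prescribed entries on \<open>A\<close>: one choice at
    each element of \<open>A\<close>, \<open>q\<close> choices at each element of
    \<open>B - A\<close>.\<close>
  let ?W = "PiE B (\<lambda>b. if b \<in> A then {w b} else UNIV)"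
  have "?W \<subseteq> range ?\<Phi>"
    unfolding surj by (intro PiE_mono) auto
  then have "?W = ?\<Phi> ` (?\<Phi> -` ?W)"
    by blast
  also have "?\<Phi> -` ?W = {x. \<forall>a\<in>A. Tr (x * a) = w a}"
    using B(1) by (auto simp: PiE_iff split: if_splits)
  finally have "card {x. \<forall>a\<in>A. Tr (x * a) = w a} = card ?W"
    by (simp only: card_image[OF inj_on_subset[OF inj subset_UNIV]])
  also have "\<dots> = (\<Prod>b\<in>B. if b \<in> A then 1 else CARD('f))"
    by (subst card_PiE) (auto intro!: prod.cong)
  also have "\<dots> = CARD('f) ^ card (B - A)"
    by (simp add: prod.If_cases Diff_eq)
  also have "card (B - A) = t - card A"
    using B(1,4) by (simp add: card_Diff_subset finite_subset)
  finally show ?thesis .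
qed

section \<open>The conditions of the theorem\<close>

lemma ks_set_trace_seq_iff:
  assumes "primitive_element \<alpha>" "inj_on ((^) \<alpha>) C" "finite C"
  shows "ks_set tuple_scale (card C) s
      ((\<lambda>c. shift_window (CARD('e) - 1) c (trace_seq emb t \<alpha>)) ` C) \<longleftrightarrow>
    ks_set (ext_scale emb) (card C) s ((^) \<alpha> ` C)"
proof -
  let ?n = "CARD('e) - 1"
  \<comment> \<open>This linear map takes \<open>\<alpha> ^ c\<close> to the window with shift
    \<open>c\<close>. It is injective because the powers of \<open>\<alpha>\<close> exhaust the
    nonzero elements and the trace form is nondegenerate.\<close>
  define \<phi> :: "'e \<Rightarrow> nat \<Rightarrow> 'f" where "\<phi> x = tuple ?n (\<lambda>i. Tr (\<alpha> ^ i * x))" for x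
  interpret T: vector_space "tuple_scale :: 'f \<Rightarrow> (nat \<Rightarrow> 'f) \<Rightarrow> _"
    by (rule vector_space_tuple_scale)
  interpret \<phi>: module_hom "ext_scale emb" tuple_scale \<phi>
    by unfold_locales
      (auto simp: \<phi>_def tuple_def tuple_scale_def distrib_left trace_add trace_mult_scale)
  have "inj \<phi>"
    unfolding \<phi>.inj_iff_eq_0
  proof (intro allI impI)
    fix x assume x: "\<phi> x = 0"
    have "Tr (x * y) = 0" for y
    proof (cases "y = 0")
      case False
      then obtain i where "i < ?n" "y = \<alpha> ^ i"
        using bij_betw_imp_surj_on[OF primitive_element_bij_betw[OF assms(1)]] by blast
      then show ?thesis
        using fun_cong[OF x, of i] by (simp add: \<phi>_def tuple_def mult.commute)
    qed simp
    then show "x = 0"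
      by (rule trace_form_nondegenerate)
  qed
  have dep: "T.dependent (\<phi> ` S) \<longleftrightarrow> dependent S" for S
  proof
    show "dependent S" if "T.dependent (\<phi> ` S)"
      using that inj_on_subset[OF \<open>inj \<phi>\<close> subset_UNIV] by (rule \<phi>.dependent_inj_imageD)
    assume "dependent S"
    then obtain u v where u: "(\<Sum>v\<in>S. ext_scale emb (u v) v) = 0" "v \<in> S" "u v \<noteq> 0"
      by (auto simp: dependent_finite)
    \<comment> \<open>A relation in \<open>S\<close> is pushed forward, its coefficients being read
      off through \<open>inv \<phi>\<close>.\<close>
    have "(\<Sum>y\<in>\<phi> ` S. tuple_scale (u (inv \<phi> y)) y) = \<phi> (\<Sum>v\<in>S. ext_scale emb (u v) v)"
      using inj_on_subset[OF \<open>inj \<phi>\<close> subset_UNIV]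
      by (simp add: sum.reindex \<open>inj \<phi>\<close> \<phi>.sum \<phi>.scale)
    then show "T.dependent (\<phi> ` S)"
      using u \<open>inj \<phi>\<close> by (auto simp: T.dependent_finite intro!: exI[of _ "\<lambda>y. u (inv \<phi> y)"])
  qed
  have window: "shift_window ?n c (trace_seq emb t \<alpha>) = \<phi> (\<alpha> ^ c)" for c
    by (simp add: shift_window_def trace_seq_def \<phi>_def power_add)
  have inj: "inj_on (\<lambda>c. \<phi> (\<alpha> ^ c)) C"
    using comp_inj_on[OF assms(2) inj_on_subset[OF \<open>inj \<phi>\<close> subset_UNIV]] by (simp add: comp_def)
  have img: "(\<lambda>c. \<phi> (\<alpha> ^ c)) ` D = \<phi> ` (^) \<alpha> ` D" for D
    by auto
  show ?thesis
    by (simp only: window ks_set_image_iff[OF inj assms(3)])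
      (simp only: img dep ks_set_image_iff[OF assms(2,3)])
qed

section \<open>Evaluation and the minimal polynomial\<close>

abbreviation ev :: "'e \<Rightarrow> 'f poly \<Rightarrow> 'e" where
  "ev x p \<equiv> poly (map_poly emb p) x"

lemma ev_add: "ev x (p + q) = ev x p + ev x q"
proof -
  have "map_poly emb (p + q) = map_poly emb p + map_poly emb q"
    by (rule poly_eqI) (simp add: coeff_map_poly)
  then show ?thesis
    by simp
qed

lemma ev_smult: "ev x (smult a p) = emb a * ev x p"
proof -
  have "map_poly emb (smult a p) = smult (emb a) (map_poly emb p)"
    by (rule poly_eqI) (simp add: coeff_map_poly)
  then show ?thesis
    by simp
qed

lemma ev_pCons: "ev x (pCons a p) = emb a + x * ev x p"
  by (simp add: map_poly_pCons)

lemma ev_mult: "ev x (p * q) = ev x p * ev x q"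
  by (induction p) (simp_all add: ev_add ev_smult ev_pCons algebra_simps)

lemma ev_sum_monom: "ev x (\<Sum>j\<in>J. monom (d j) (c j)) = (\<Sum>j\<in>J. emb (d j) * x ^ c j)"
  by (induction J rule: infinite_finite_induct) (simp_all add: ev_add map_poly_monom poly_monom)

text \<open>Reduction modulo \<open>m\<close> keeps the value at \<open>\<alpha>\<close>, and a
  nonzero remainder with root \<open>\<alpha>\<close> would contradict the minimality of the
  degree.\<close>

lemma minimal_polynomial_dvd_iff:
  assumes "is_minimal_polynomial emb \<alpha> m"
  shows "m dvd p \<longleftrightarrow> ev \<alpha> p = 0"
proof
  from assms have m: "ev \<alpha> m = 0" "m \<noteq> 0"
    by (auto simp: is_minimal_polynomial_def)
  then show "ev \<alpha> p = 0" if "m dvd p"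
    using that by (auto simp: ev_mult elim!: dvdE)
  assume "ev \<alpha> p = 0"
  then have "ev \<alpha> (p mod m) = 0"
    using ev_add[of "m * (p div m)" "p mod m" \<alpha>] m by (simp add: ev_mult)
  then have "p mod m = 0 \<or> degree m \<le> degree (p mod m)"
    using assms by (auto simp: is_minimal_polynomial_def)
  then have "p mod m = 0"
    using degree_mod_less[of m p] m by auto
  then show "m dvd p"
    by (simp add: mod_eq_0_iff_dvd)
qed

text \<open>A sum of monomials divisible by \<open>m\<close> is a linear relation between powers of
  \<open>\<alpha>\<close>, and the injective families \<open>c\<close> enumerate the
  \<open>s\<close>-element subsets of \<open>C\<close>.\<close>

lemma minimal_polynomial_not_dvd_iff:
  assumes "is_minimal_polynomial emb \<alpha> m" "inj_on ((^) \<alpha>) C" "finite C"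
  shows "(\<forall>c d. (\<forall>j<s. c j \<in> C) \<and> inj_on c {..<s} \<and> (\<exists>j<s. d j \<noteq> 0)
      \<longrightarrow> \<not> m dvd (\<Sum>j<s. monom (d j) (c j))) \<longleftrightarrow>
    (\<forall>D\<subseteq>C. card D = s \<longrightarrow> independent ((^) \<alpha> ` D))" (is "?L \<longleftrightarrow> ?R")
proof
  assume L: ?L
  show ?R
  proof (intro allI impI notI)
    fix D assume D: "D \<subseteq> C" "card D = s" and dep: "dependent ((^) \<alpha> ` D)"
    have fin: "finite D"
      using D(1) assms(3) by (rule finite_subset)
    have inj: "inj_on ((^) \<alpha>) D"
      using assms(2) D(1) by (rule inj_on_subset)
    obtain c where c: "bij_betw c {..<s} D"
      using ex_bij_betw_nat_finite[OF fin] D(2) by (auto simp: atLeast0LessThan)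
    obtain u where u: "\<exists>x\<in>D. u (\<alpha> ^ x) \<noteq> 0"
      "(\<Sum>v\<in>(^) \<alpha> ` D. ext_scale emb (u v) v) = 0"
      using dep fin by (auto simp: dependent_finite)
    have "(\<Sum>j<s. emb (u (\<alpha> ^ c j)) * \<alpha> ^ c j) = 0"
      using u(2) sum.reindex_bij_betw[OF c, of "\<lambda>x. emb (u (\<alpha> ^ x)) * \<alpha> ^ x"]
      by (simp add: sum.reindex[OF inj] ext_scale_def)
    then have "m dvd (\<Sum>j<s. monom (u (\<alpha> ^ c j)) (c j))"
      by (simp add: minimal_polynomial_dvd_iff[OF assms(1)] ev_sum_monom)
    moreover have "\<forall>j<s. c j \<in> C" "inj_on c {..<s}" "\<exists>j<s. u (\<alpha> ^ c j) \<noteq> 0"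
      using c D(1) u(1) by (auto simp: bij_betw_def)
    ultimately show False
      using L[rule_format, of c "\<lambda>j. u (\<alpha> ^ c j)"] by simp
  qed
next
  assume R: ?R
  show ?L
  proof (intro allI impI notI, elim conjE)
    fix c d
    assume c: "\<forall>j<s. c j \<in> C" "inj_on c {..<s}" and d: "\<exists>j<s. d j \<noteq> 0"
      and dvd: "m dvd (\<Sum>j<s. monom (d j) (c j))"
    let ?f = "\<lambda>j. \<alpha> ^ c j"
    have sub: "c ` {..<s} \<subseteq> C"
      using c(1) by auto
    have "inj_on ?f {..<s}"
      using comp_inj_on[OF c(2) inj_on_subset[OF assms(2) sub]] by (simp add: comp_def)
    \<comment> \<open>The family \<open>d\<close> becomes a coefficient function on vectors, well
      defined because \<open>?f\<close> is injective.\<close>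
    then have inv: "the_inv_into {..<s} ?f (\<alpha> ^ c j) = j" if "j < s" for j
      using that by (intro the_inv_into_f_f) auto
    have "independent (?f ` {..<s})"
      using R[rule_format, OF sub] c(2) by (simp add: card_image image_image)
    moreover have "(\<Sum>v\<in>?f ` {..<s}. ext_scale emb (d (the_inv_into {..<s} ?f v)) v) = 0"
      using dvd \<open>inj_on ?f {..<s}\<close>
      by (simp add: minimal_polynomial_dvd_iff[OF assms(1)] ev_sum_monom sum.reindex
          ext_scale_def inv cong: sum.cong_simp)
    ultimately have "d (the_inv_into {..<s} ?f (?f j)) = 0" if "j < s" for j
      using that by (intro independentD) auto
    with d show False
      by (auto simp: inv)
  qed
qed

section \<open>Flats\<close>

lemma proj_point_in_flat_iff:
  assumes "x \<noteq> 0" "subspace S"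
  shows "proj_point emb x \<in> proj_point emb ` (S - {0}) \<longleftrightarrow> x \<in> S"
proof
  assume "proj_point emb x \<in> proj_point emb ` (S - {0})"
  then obtain y where "y \<in> S" "span {x} = span {y}"
    by (auto simp: proj_point_def)
  then show "x \<in> S"
    using span_base[of x "{x}"] span_minimal[of "{y}" S] assms(2) by auto
qed (use assms(1) in auto)

text \<open>Both sides say that \<open>A\<close> fits into a subspace of dimension
  \<open>card A - 1\<close>, the vector dimension of a flat of dimension \<open>card A - 2\<close>.
  The bound \<open>card A \<le> t + 1\<close> guarantees that such a subspace exists.\<close>

lemma dependent_iff_in_flat:
  assumes "1 \<le> card A" "card A \<le> t + 1" "0 \<notin> A"
  shows "dependent A \<longleftrightarrow>
    (\<exists>F. is_flat emb (int (card A) - 2) F \<and> (\<forall>x\<in>A. proj_point emb x \<in> F))"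
proof
  assume dep: "dependent A"
  obtain B where B: "B \<subseteq> A" "independent B" "A \<subseteq> span B"
    using maximal_independent_subset by metis
  have "B \<subset> A"
    using B dep by auto
  then have "card B \<le> card A - 1"
    using psubset_card_mono[of A B] by auto
  moreover obtain E where E: "B \<subseteq> E" "independent E" "span E = UNIV" "card E = t"
    using extend_to_basis[OF B(2)] .
  moreover have "card A - 1 \<le> card E"
    using assms(2) E(4) by simp
  \<comment> \<open>\<open>B\<close> may have fewer than \<open>card A - 1\<close> elements, so it
    is enlarged inside the basis \<open>E\<close> to exactly the required dimension.\<close>
  ultimately obtain G where G: "B \<subseteq> G" "G \<subseteq> E" "card G = card A - 1"
    using exists_subset_between[of B "card A - 1" E] by (metis finite)
  have "A \<subseteq> span G"
    using B(3) span_mono[OF G(1)] by auto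
  then have "\<forall>x\<in>A. proj_point emb x \<in> proj_point emb ` (span G - {0})"
    using assms(3) by auto
  moreover have "dim (span G) = card A - 1"
    using independent_mono[OF E(2) G(2)] G(3) by (simp add: dim_eq_card_independent)
  then have "is_flat emb (int (card A) - 2) (proj_point emb ` (span G - {0}))"
    unfolding is_flat_def using assms(1) by (intro exI[of _ "span G"]) auto
  ultimately show "\<exists>F. is_flat emb (int (card A) - 2) F \<and> (\<forall>x\<in>A. proj_point emb x \<in> F)"
    by blast
next
  assume "\<exists>F. is_flat emb (int (card A) - 2) F \<and> (\<forall>x\<in>A. proj_point emb x \<in> F)"
  then obtain S where S: "subspace S" "int (dim S) = int (card A) - 1"
    and A: "\<And>x. x \<in> A \<Longrightarrow> proj_point emb x \<in> proj_point emb ` (S - {0})"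
    by (auto simp: is_flat_def)
  have sub: "A \<subseteq> S"
  proof
    fix x assume x: "x \<in> A"
    with assms(3) have "x \<noteq> 0"
      by auto
    from proj_point_in_flat_iff[OF this S(1)] A[OF x] show "x \<in> S"
      by blast
  qed
  show "dependent A"
  proof (rule ccontr)
    assume "independent A"
    then obtain B where B: "A \<subseteq> B" "B \<subseteq> S" "independent B" "S \<subseteq> span B"
      using maximal_independent_subset_extend[OF sub] by blast
    then have "card A \<le> dim S"
      using basis_card_eq_dim[OF B(2,4,3)] card_mono[OF _ B(1)] by simp
    with S(2) show False
      by simp
  qed
qed

section \<open>Rows of the trace array\<close>

definition row_elt :: "'e \<Rightarrow> nat \<Rightarrow> 'e" where
  "row_elt \<alpha> i = (if i < CARD('e) - 1 then \<alpha> ^ i else 0)"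

lemma trace_array_eq: "trace_array emb t \<alpha> cs i j = Tr (row_elt \<alpha> i * \<alpha> ^ (cs ! j))"
  by (simp add: trace_array_def row_elt_def power_add)

text \<open>The zero row supplies the one element that is not a power of \<open>\<alpha>\<close>, so
  rows correspond to all elements of the field.\<close>

lemma bij_betw_row_elt:
  assumes "primitive_element \<alpha>"
  shows "bij_betw (row_elt \<alpha>) {..<CARD('e)} UNIV"
proof -
  let ?n = "CARD('e) - 1"
  have "bij_betw (row_elt \<alpha>) {..<?n} (- {0})"
    using primitive_element_bij_betw[OF assms]
    by (rule bij_betw_cong[THEN iffD1, rotated]) (simp add: row_elt_def)
  then have "bij_betw (row_elt \<alpha>) ({..<?n} \<union> {?n}) (- {0} \<union> {0})"
    by (rule bij_betw_combine) (auto simp: row_elt_def bij_betw_def)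
  moreover have "{..<?n} \<union> {?n} = {..<CARD('e)}"
    using card_field_ge_2[where 'a = 'e] by auto
  ultimately show ?thesis
    by (simp add: Un_commute insert_def[symmetric])
qed

text \<open>The rows form the image of the whole field under the linear map \<open>\<psi>\<close>,
  whatever the exponents are.\<close>

lemma subspace_row_set:
  assumes "primitive_element \<alpha>"
  shows "module.subspace tuple_scale (row_set k (CARD('e)) (trace_array emb t \<alpha> cs))"
proof -
  define \<psi> :: "'e \<Rightarrow> nat \<Rightarrow> 'f" where "\<psi> x = tuple k (\<lambda>j. Tr (x * \<alpha> ^ (cs ! j)))" for x
  interpret T: vector_space "tuple_scale :: 'f \<Rightarrow> (nat \<Rightarrow> 'f) \<Rightarrow> _"
    by (rule vector_space_tuple_scale)
  interpret \<psi>: module_hom "ext_scale emb" tuple_scale \<psi>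
  proof
    fix d x
    have "ext_scale emb d x * y = ext_scale emb d (x * y)" for y
      by (simp add: ext_scale_def)
    then show "\<psi> (ext_scale emb d x) = tuple_scale d (\<psi> x)"
      by (auto simp: \<psi>_def tuple_def tuple_scale_def trace_scale)
  qed (auto simp: \<psi>_def tuple_def distrib_right trace_add)
  have "tuple k (trace_array emb t \<alpha> cs i) = \<psi> (row_elt \<alpha> i)" for i
    by (auto simp: \<psi>_def tuple_def trace_array_eq)
  then have "row_set k (CARD('e)) (trace_array emb t \<alpha> cs) = \<psi> ` row_elt \<alpha> ` {..<CARD('e)}"
    by (simp add: row_set_def image_image)
  also have "row_elt \<alpha> ` {..<CARD('e)} = UNIV"
    using bij_betw_row_elt[OF assms] by (rule bij_betw_imp_surj_on)
  finally show ?thesis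
    using \<psi>.subspace_image[OF subspace_UNIV] by simp
qed

text \<open>Equal rows give two trace functionals that agree on a spanning set, hence come from the
  same field element.\<close>

lemma distinct_rows_trace_array:
  assumes "primitive_element \<alpha>" "span ((^) \<alpha> ` set cs) = UNIV"
  shows "distinct_rows (length cs) (CARD('e)) (trace_array emb t \<alpha> cs)"
  unfolding distinct_rows_def
proof (rule inj_onI)
  fix i i' assume i: "i \<in> {..<CARD('e)}" "i' \<in> {..<CARD('e)}"
    and eq: "tuple (length cs) (trace_array emb t \<alpha> cs i) = tuple (length cs) (trace_array emb t \<alpha> cs i')"
  have "Tr (row_elt \<alpha> i * \<alpha> ^ (cs ! j)) = Tr (row_elt \<alpha> i' * \<alpha> ^ (cs ! j))" if "j < length cs" for j
    using fun_cong[OF eq, of j] that by (simp add: tuple_def trace_array_eq)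
  then have "row_elt \<alpha> i = row_elt \<alpha> i'"
    by (intro trace_form_eq_on_span[OF _ assms(2)]) (auto simp: in_set_conv_nth)
  with i show "i = i'"
    using bij_betw_imp_inj_on[OF bij_betw_row_elt[OF assms(1)]] by (auto dest: inj_onD)
qed

lemma card_rows_trace_array:
  assumes "primitive_element \<alpha>"
  shows "card {i. i < CARD('e) \<and> (\<forall>j\<in>J. trace_array emb t \<alpha> cs i j = w j)} =
    card {x. \<forall>j\<in>J. Tr (x * \<alpha> ^ (cs ! j)) = w j}"
proof (rule bij_betw_same_card)
  let ?X = "{x. \<forall>j\<in>J. Tr (x * \<alpha> ^ (cs ! j)) = w j}"
  have "inj_on (row_elt \<alpha>) {..<CARD('e)}" "row_elt \<alpha> ` {..<CARD('e)} = UNIV"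
    using bij_betw_row_elt[OF assms] by (auto simp: bij_betw_def)
  moreover have "{i. i < CARD('e) \<and> (\<forall>j\<in>J. trace_array emb t \<alpha> cs i j = w j)} =
      {..<CARD('e)} \<inter> row_elt \<alpha> -` ?X"
    by (auto simp: trace_array_eq)
  moreover have "row_elt \<alpha> ` ({..<CARD('e)} \<inter> row_elt \<alpha> -` ?X) = row_elt \<alpha> ` {..<CARD('e)} \<inter> ?X"
    by blast
  ultimately show "bij_betw (row_elt \<alpha>)
      {i. i < CARD('e) \<and> (\<forall>j\<in>J. trace_array emb t \<alpha> cs i j = w j)} ?X"
    by (auto simp only: bij_betw_def Int_UNIV_left intro: inj_on_subset)
qed

lemma orthogonal_array_trace_array_iff:
  assumes "primitive_element \<alpha>" "inj_on ((^) \<alpha>) (set cs)" "distinct cs" "s \<le> length cs"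
  shows "orthogonal_array (CARD('f) ^ (t - s)) s (length cs) UNIV (CARD('e)) (trace_array emb t \<alpha> cs) \<longleftrightarrow>
    (\<forall>D\<subseteq>set cs. card D = s \<longrightarrow> independent ((^) \<alpha> ` D))" (is "?L \<longleftrightarrow> ?R")
proof -
  let ?k = "length cs" and ?g = "\<lambda>j. \<alpha> ^ (cs ! j)"
  have set_cs: "set cs = (!) cs ` {..<?k}"
    by (auto simp: in_set_conv_nth)
  have inj: "inj_on ?g {..<?k}"
    using comp_inj_on[of "(!) cs" "{..<?k}" "(^) \<alpha>"] assms(2,3)
    by (simp add: comp_def inj_on_nth flip: set_cs)
  \<comment> \<open>Sets of exponents are replaced by sets of column positions, which index the
    array.\<close>
  have R_iff: "?R \<longleftrightarrow> (\<forall>J\<subseteq>{..<?k}. card J = s \<longrightarrow> independent (?g ` J))"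
  proof -
    have "card ((!) cs ` J) = card J" if "J \<subseteq> {..<?k}" for J
      using that assms(3) by (intro card_image inj_on_nth) auto
    then show ?thesis
      unfolding set_cs by (simp add: all_subset_image image_image)
  qed
  show ?thesis
    unfolding R_iff
  proof
    assume L: ?L
    show "\<forall>J\<subseteq>{..<?k}. card J = s \<longrightarrow> independent (?g ` J)"
    proof (intro allI impI notI)
      fix J assume J: "J \<subseteq> {..<?k}" "card J = s" and dep: "dependent (?g ` J)"
      have fin: "finite J"
        using J(1) finite_subset by blast
      obtain u j0 where u: "(\<Sum>v\<in>?g ` J. ext_scale emb (u v) v) = 0" "j0 \<in> J" "u (?g j0) \<noteq> 0"
        using dep fin by (auto simp: dependent_finite)
      \<comment> \<open>The pattern singles out a column with nonzero coefficient. On a row showing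
        it, the linear relation collapses to \<open>u (?g j0) = 0\<close>.\<close>
      define w :: "nat \<Rightarrow> 'f" where "w j = (if j = j0 then 1 else 0)" for j
      have "card {x. \<forall>j\<in>J. Tr (x * ?g j) = w j} = CARD('f) ^ (t - s)"
        using L J by (simp add: orthogonal_array_def card_rows_trace_array[OF assms(1)])
      \<comment> \<open>A power of \<open>q\<close> is positive even if the difference
        \<open>t - s\<close> is truncated.\<close>
      then have "card {x. \<forall>j\<in>J. Tr (x * ?g j) = w j} \<noteq> 0"
        by simp
      then obtain x where x: "\<And>j. j \<in> J \<Longrightarrow> Tr (x * ?g j) = w j"
        by (auto simp: card_eq_0_iff)
      have "0 = Tr (x * (\<Sum>j\<in>J. ext_scale emb (u (?g j)) (?g j)))"
        using u(1) by (simp add: sum.reindex[OF inj_on_subset[OF inj J(1)]])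
      also have "\<dots> = (\<Sum>j\<in>J. u (?g j) * w j)"
        by (simp add: sum_distrib_left trace_sum trace_mult_scale x)
      also have "\<dots> = u (?g j0)"
        using fin u(2) by (simp add: w_def if_distrib cong: if_cong)
      finally show False
        using u(3) by simp
    qed
  next
    assume R: "\<forall>J\<subseteq>{..<?k}. card J = s \<longrightarrow> independent (?g ` J)"
    have card_g: "card (?g ` J) = card J" if "J \<subseteq> {..<?k}" for J
      using that by (intro card_image inj_on_subset[OF inj])
    \<comment> \<open>As \<open>s \<le> length cs\<close>, some set of \<open>s\<close> columns
      exists; its independence makes \<open>t - s\<close> a true difference, so the number of rows
      is right.\<close>
    have "s \<le> t"
      using R[rule_format, of "{..<s}"] independent_card_le[of "?g ` {..<s}"] assms(4)
        card_g[of "{..<s}"] by simp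
    then have "CARD('e) = CARD('f) ^ (t - s) * CARD('f) ^ s"
      by (simp add: card_ext flip: power_add)
    moreover have "card {x. \<forall>j\<in>J. Tr (x * ?g j) = w j} = CARD('f) ^ (t - s)"
      if J: "J \<subseteq> {..<?k}" "card J = s" for J w
    proof -
      have "the_inv_into J ?g (?g j) = j" if "j \<in> J" for j
        using that by (intro the_inv_into_f_f inj_on_subset[OF inj J(1)])
      then have "{x. \<forall>j\<in>J. Tr (x * ?g j) = w j} =
          {x. \<forall>a\<in>?g ` J. Tr (x * a) = w (the_inv_into J ?g a)}"
        by simp
      also have "card \<dots> = CARD('f) ^ (t - s)"
        using card_trace_fiber[OF R[rule_format, OF J], of "\<lambda>a. w (the_inv_into J ?g a)"]
        by (simp only: card_g[OF J(1)] J(2))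
      finally show ?thesis .
    qed
    ultimately show ?L
      unfolding orthogonal_array_def card_rows_trace_array[OF assms(1)]
      using assms(4) by simp
  qed
qed

end

text \<open>For \<open>s > t + 1\<close> there is no subspace of dimension \<open>s - 1\<close>, so
  \<open>P5\<close> holds vacuously while \<open>P4\<close> fails; hence the bound on
  \<open>s\<close> there. \<open>P1\<close> demands distinct rows, which a nonzero element
  orthogonal to all the powers would destroy; hence the spanning condition. With
  \<open>s > length cs\<close>, \<open>P4\<close> and \<open>P5\<close> would be vacuous but
  \<open>P2\<close> false.\<close>

theorem mainTheorem5:
  fixes emb :: "'f::{field,finite} \<Rightarrow> 'e::{field,finite}"
    and t s :: nat and \<alpha> :: 'e and m :: "'f poly" and cs :: "nat list"
  assumes emb: "field_embedding emb"
    and t: "t \<ge> 1" and card_e: "CARD('e) = CARD('f) ^ t"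
    and s: "s \<ge> 1"
    and alpha: "primitive_element \<alpha>"
    and m: "is_minimal_polynomial emb \<alpha> m"
    and cs: "cs \<noteq> []" "distinct cs" "set cs \<subseteq> {0..CARD('e) - 2}"
    and s_le: "s \<le> length cs"
  shows
    "let k = length cs;
         lam = CARD('f) ^ (t - s);
         A = trace_array emb t \<alpha> cs;
         P1 = linear_orthogonal_array lam s k (CARD('e)) A;
         P1_rep = linear_orthogonal_array_rep lam s k (CARD('e)) A;
         P2 = ks_set (ext_scale emb) k s ((\<lambda>c. \<alpha> ^ c) ` set cs);
         P3 = ks_set tuple_scale k s
                ((\<lambda>c. shift_window (CARD('e) - 1) c (trace_seq emb t \<alpha>)) ` set cs);
         P4 = (\<forall>c d. (\<forall>j<s. c j \<in> set cs) \<and> inj_on c {..<s} \<and> (\<exists>j<s. d j \<noteq> 0)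
                \<longrightarrow> \<not> m dvd (\<Sum>j<s. monom (d j) (c j)));
         P5 = (\<forall>D\<subseteq>set cs. card D = s \<longrightarrow>
                \<not> (\<exists>F. is_flat emb (int s - 2) F \<and> (\<forall>c\<in>D. proj_point emb (\<alpha> ^ c) \<in> F)))
     in (P1_rep \<longleftrightarrow> P2) \<and> (P2 \<longleftrightarrow> P3) \<and> (P3 \<longleftrightarrow> P4) \<and>
        (s \<le> t + 1 \<longrightarrow> (P4 \<longleftrightarrow> P5)) \<and>
        (module.span (ext_scale emb) ((\<lambda>c. \<alpha> ^ c) ` set cs) = UNIV \<longrightarrow> (P1 \<longleftrightarrow> P2))"
proof -
  interpret finite_extension emb t
    using emb card_e by unfold_locales
  have card_cs: "card (set cs) = length cs"
    using cs(2) by (rule distinct_card)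
  \<comment> \<open>Exponents below the order of \<open>\<alpha>\<close> give distinct
    powers.\<close>
  have "set cs \<subseteq> {..<CARD('e) - 1}"
    using cs(3) card_field_ge_2[where 'a = 'e] by auto
  then have inj: "inj_on ((^) \<alpha>) (set cs)"
    using bij_betw_imp_inj_on[OF primitive_element_bij_betw[OF alpha]] by (auto intro: inj_on_subset)
  have nz: "\<alpha> \<noteq> 0"
  proof -
    have "\<alpha> powi 1 \<in> - {0}"
      using alpha unfolding primitive_element_def by blast
    then show ?thesis
      by simp
  qed
  \<comment> \<open>The hub of the proof: every condition is shown equivalent to this one.\<close>
  let ?indep = "\<forall>D\<subseteq>set cs. card D = s \<longrightarrow> independent ((^) \<alpha> ` D)"
  let ?A = "trace_array emb t \<alpha> cs"
  have P2: "ks_set (ext_scale emb) (length cs) s ((^) \<alpha> ` set cs) \<longleftrightarrow> ?indep"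
    using ks_set_image_iff[OF inj, where scale = "ext_scale emb"] s_le by (simp add: card_cs)
  have P3: "ks_set tuple_scale (length cs) s
      ((\<lambda>c. shift_window (CARD('e) - 1) c (trace_seq emb t \<alpha>)) ` set cs) \<longleftrightarrow> ?indep"
    using ks_set_trace_seq_iff[OF alpha inj, of s] P2 by (simp add: card_cs)
  have P1_rep: "linear_orthogonal_array_rep (CARD('f) ^ (t - s)) s (length cs) (CARD('e)) ?A \<longleftrightarrow> ?indep"
    using orthogonal_array_trace_array_iff[OF alpha inj cs(2) s_le] subspace_row_set[OF alpha]
    by (simp add: linear_orthogonal_array_rep_def)
  have P1: "linear_orthogonal_array (CARD('f) ^ (t - s)) s (length cs) (CARD('e)) ?A \<longleftrightarrow> ?indep"
    if "span ((^) \<alpha> ` set cs) = UNIV"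
    using P1_rep distinct_rows_trace_array[OF alpha that]
    by (simp add: linear_orthogonal_array_rep_def linear_orthogonal_array_def)
  have P4: "(\<forall>c d. (\<forall>j<s. c j \<in> set cs) \<and> inj_on c {..<s} \<and> (\<exists>j<s. d j \<noteq> 0)
      \<longrightarrow> \<not> m dvd (\<Sum>j<s. monom (d j) (c j))) \<longleftrightarrow> ?indep"
    using minimal_polynomial_not_dvd_iff[OF m inj] by simp
  have P5: "(\<forall>D\<subseteq>set cs. card D = s \<longrightarrow>
      \<not> (\<exists>F. is_flat emb (int s - 2) F \<and> (\<forall>c\<in>D. proj_point emb (\<alpha> ^ c) \<in> F))) \<longleftrightarrow> ?indep"
    if "s \<le> t + 1"
  proof -
    have "dependent ((^) \<alpha> ` D) \<longleftrightarrow>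
        (\<exists>F. is_flat emb (int s - 2) F \<and> (\<forall>c\<in>D. proj_point emb (\<alpha> ^ c) \<in> F))"
      if "D \<subseteq> set cs" "card D = s" for D
    proof -
      have "card ((^) \<alpha> ` D) = s"
        using card_image[OF inj_on_subset[OF inj that(1)]] that(2) by simp
      moreover have "0 \<notin> (^) \<alpha> ` D"
        using nz by auto
      ultimately show ?thesis
        using dependent_iff_in_flat[of "(^) \<alpha> ` D"] s \<open>s \<le> t + 1\<close> by simp
    qed
    then show ?thesis
      by (intro iff_allI imp_cong refl) (simp only:)
  qed
  show ?thesis
    unfolding Let_def P1_rep P2 P3 P4 by (intro conjI impI refl P1 P5[symmetric])
qed

end
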